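(* Let $\theta$ be a positive random variable with a posterior density function $f$ and such that $\mathbb{E}(\theta^k)<\infty$ and $\mathbb{E}(\theta^{-k})<\infty$, where $\mathbb{E}$ denotes the posterior mean with respect to $f$ and $k>0$. Then: (a) The expectation with respect to $f$ of the loss function $L_k(\theta,d)=\left(\frac{d}{\theta}\right)^k+\left(\frac{\theta}{d}\right)^k-2$ is minimized by the Bayes estimator (scale mean) $$\hat d_k=\left(\frac{\mathbb{E}(\theta^k)}{\mathbb{E}(\theta^{-k})}\right)^{\frac{1}{2k}}.$$ (b) The expectation with respect to $f$ of the precautionary loss function $L_{sq}(\theta,d)=\frac{(d-\theta)^2}{d}$ is minimized by the Bayes estimator (scale mean) $$\hat d_{sq}=\sqrt{\mathbb{E}(\theta^2)},$$ for which the following bound holds: $\hat d_{sq}\ge\mathbb{E}(\theta)$.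
   Context: A loss function $L(\theta,d)$ assigns a penalty to the decision $d$ when the parameter equals $\theta$; here both $\theta$ and $d$ lie in $(0,+\infty)$. The Bayes estimator associated with $L$ is the decision $d$ minimizing the expected loss $\mathbb{E}(L(\theta,d))$, the expectation being over the posterior distribution of $\theta$. The term "scale mean" is used for such a minimizer in this setting of a positive (scale) parameter.
   Formalization: Part (b) is proved under the additional assumption that E(θ²) is finite, which the stated moment conditions do not imply for k < 2; without it the expected precautionary loss is infinite for every d and √E(θ²) is not a decision in (0,∞). *)

theory Defs
  imports "HOL-Probability.Probability"
begin

text \<open>
  Loss functions take the parameter first and the decision second; both are meant to be positive.
\<close>

definition scale_loss :: "real \<Rightarrow> real \<Rightarrow> real \<Rightarrow> real" where
  "scale_loss k \<theta> d = (d / \<theta>) powr k + (\<theta> / d) powr k - 2"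

definition precautionary_loss :: "real \<Rightarrow> real \<Rightarrow> real" where
  "precautionary_loss \<theta> d = (d - \<theta>)\<^sup>2 / d"

definition expected_loss ::
  "'a measure \<Rightarrow> ('a \<Rightarrow> real) \<Rightarrow> (real \<Rightarrow> real \<Rightarrow> real) \<Rightarrow> real \<Rightarrow> real" where
  "expected_loss M \<theta> L d = (\<integral>\<omega>. L (\<theta> \<omega>) d \<partial>M)"

text \<open>
  The decision space is the open half-line of positive reals. The Bochner integral of a
  non-integrable function is 0, so integrability of the loss at every decision is required
  explicitly. Uniqueness of the minimizer is not part of the definition.
\<close>

definition bayes_estimator ::
  "'a measure \<Rightarrow> ('a \<Rightarrow> real) \<Rightarrow> (real \<Rightarrow> real \<Rightarrow> real) \<Rightarrow> real \<Rightarrow> bool" where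
  "bayes_estimator M \<theta> L d \<longleftrightarrow>
     (\<forall>d'>0. integrable M (\<lambda>\<omega>. L (\<theta> \<omega>) d')) \<and>
     is_arg_min (expected_loss M \<theta> L) (\<lambda>d'. 0 < d') d"

end

theory Submission
  imports Defs
begin

text \<open>
  Both losses separate the decision from the parameter, so both expected losses have the shape
  \<open>A d\<^sup>k + B d\<^sup>-\<^sup>k + c\<close> in the decision \<open>d > 0\<close>, with constants \<open>A, B > 0\<close>. For the scale loss,
  \<open>A = E(\<theta>\<^sup>-\<^sup>k)\<close>, \<open>B = E(\<theta>\<^sup>k)\<close> and \<open>c = -2\<close>; for the precautionary loss the exponent is 1 and
  \<open>A = 1\<close>, \<open>B = E(\<theta>\<^sup>2)\<close>, \<open>c = -2 E(\<theta>)\<close>, because \<open>(d - \<theta>)\<^sup>2 / d = d - 2\<theta> + \<theta>\<^sup>2 / d\<close>.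

  Completing the square in \<open>u = d\<^sup>k\<close> turns \<open>A u + B / u\<close> into \<open>2 A v + A (u - v)\<^sup>2 / u\<close> with
  \<open>v\<^sup>2 = B / A\<close>, so the unique minimizer is the \<open>d\<close> with \<open>d\<^sup>2\<^sup>k = B / A\<close>
  (\<open>powr_balance_strict_min\<close>). This is transferred to Bayes estimators once, in
  \<open>bayes_estimator_powr_balance\<close>, and both parts are instances. The bound
  \<open>E(\<theta>) \<le> sqrt (E(\<theta>\<^sup>2))\<close> falls out as well: the minimal expected precautionary loss is
  \<open>2 (sqrt (E(\<theta>\<^sup>2)) - E(\<theta>))\<close>, and the loss is nonnegative.
\<close>

text \<open>
  This is the strict inequality of arithmetic and geometric means for the two terms
  \<open>A d\<^sup>k\<close> and \<open>B d\<^sup>-\<^sup>k\<close>, whose product is constant: the sum is least exactly where they balance.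
\<close>

lemma powr_balance_strict_min:
  fixes A B k d m :: real
  assumes "0 < A" "0 < B" "0 < k" "0 < d"
    and m: "m = (B / A) powr (1 / (2 * k))" and "d \<noteq> m"
  shows "A * m powr k + B * m powr (- k) < A * d powr k + B * d powr (- k)"
proof -
  define u v where "u = d powr k" and "v = m powr k"
  have "0 < m" using assms by simp
  have "0 < u" "0 < v" using \<open>0 < d\<close> \<open>0 < m\<close> by (simp_all add: u_def v_def)
  have "v\<^sup>2 = m powr (2 * k)"
    by (simp add: v_def power2_eq_square flip: powr_add)
  also have "\<dots> = B / A"
    using assms by (simp add: m powr_powr)
  finally have B: "B = A * v\<^sup>2"
    using \<open>0 < A\<close> by (simp add: field_simps)
  have "u \<noteq> v"
    using assms \<open>0 < m\<close> unfolding u_def v_def by (smt (verit) powr_less_mono2)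
  then have "0 < A * (u - v)\<^sup>2 / u"
    using \<open>0 < A\<close> \<open>0 < u\<close> by simp
  also have "\<dots> = (A * u + B / u) - (A * v + B / v)"
    using \<open>0 < u\<close> \<open>0 < v\<close> by (simp add: B field_simps power2_eq_square)
  finally show ?thesis
    by (simp add: u_def v_def powr_minus divide_inverse)
qed

lemma bayes_estimator_powr_balance:
  fixes A B c k d :: real
  assumes AB: "0 < A" "0 < B" and k: "0 < k"
    and int: "\<And>d. 0 < d \<Longrightarrow> integrable M (\<lambda>\<omega>. L (\<theta> \<omega>) d)"
    and risk: "\<And>d. 0 < d \<Longrightarrow> expected_loss M \<theta> L d = A * d powr k + B * d powr (- k) + c"
  shows "bayes_estimator M \<theta> L d \<longleftrightarrow> d = (B / A) powr (1 / (2 * k))"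
proof -
  define m where "m = (B / A) powr (1 / (2 * k))"
  have "0 < m" using AB by (simp add: m_def)
  have less: "expected_loss M \<theta> L m < expected_loss M \<theta> L x" if "0 < x" "x \<noteq> m" for x
    using powr_balance_strict_min[OF AB k \<open>0 < x\<close> m_def \<open>x \<noteq> m\<close>] \<open>0 < m\<close> \<open>0 < x\<close>
    by (simp add: risk)
  have "is_arg_min (expected_loss M \<theta> L) (\<lambda>x. 0 < x) d \<longleftrightarrow> d = m"
    unfolding is_arg_min_def using less \<open>0 < m\<close> by (metis less_asym less_irrefl)
  then show ?thesis
    using int by (simp add: bayes_estimator_def m_def)
qed

text \<open>
  The scale loss splits only where the parameter is positive, hence only almost surely;
  this is what passes the splitting on to the expectation.
\<close>

lemma integral_cong_AE_integrable:
  fixes f g :: "'a \<Rightarrow> real"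
  assumes "integrable M g" "f \<in> borel_measurable M" "AE x in M. f x = g x"
  shows "integrable M f" "integral\<^sup>L M f = integral\<^sup>L M g"
  using assms by (auto intro: integral_cong_AE simp: integrable_cong_AE[OF assms(2) _ assms(3)])

lemma scale_loss_split:
  fixes k t d :: real
  assumes "0 < t" "0 < d"
  shows "scale_loss k t d = d powr k * t powr (- k) + d powr (- k) * t powr k - 2"
  using assms by (simp add: scale_loss_def powr_divide powr_minus_divide)

lemma precautionary_loss_split:
  fixes t d :: real
  assumes "0 < d"
  shows "precautionary_loss t d = d - 2 * t + t\<^sup>2 / d"
  using assms by (simp add: precautionary_loss_def power2_eq_square field_simps)

context prob_space
begin

lemma expected_scale_loss:
  fixes \<theta> :: "'a \<Rightarrow> real"
  assumes [measurable]: "\<theta> \<in> borel_measurable M"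
    and pos: "AE \<omega> in M. 0 < \<theta> \<omega>" and "0 < d"
    and [simp]: "integrable M (\<lambda>\<omega>. \<theta> \<omega> powr k)" "integrable M (\<lambda>\<omega>. \<theta> \<omega> powr (- k))"
  shows "integrable M (\<lambda>\<omega>. scale_loss k (\<theta> \<omega>) d)" (is ?int)
    and "expected_loss M \<theta> (scale_loss k) d =
      (\<integral>\<omega>. \<theta> \<omega> powr (- k) \<partial>M) * d powr k + (\<integral>\<omega>. \<theta> \<omega> powr k \<partial>M) * d powr (- k) + (- 2)"
      (is ?eq)
proof -
  let ?g = "\<lambda>\<omega>. d powr k * \<theta> \<omega> powr (- k) + d powr (- k) * \<theta> \<omega> powr k - 2"
  have int: "integrable M ?g" by simp
  have meas: "(\<lambda>\<omega>. scale_loss k (\<theta> \<omega>) d) \<in> borel_measurable M"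
    unfolding scale_loss_def by measurable
  have ae: "AE \<omega> in M. scale_loss k (\<theta> \<omega>) d = ?g \<omega>"
    using pos by eventually_elim (simp add: scale_loss_split \<open>0 < d\<close>)
  note * = integral_cong_AE_integrable[OF int meas ae]
  show ?int by (fact *(1))
  show ?eq by (simp add: expected_loss_def *(2) prob_space)
qed

lemma expected_precautionary_loss:
  fixes \<theta> :: "'a \<Rightarrow> real"
  assumes [simp]: "integrable M \<theta>" "integrable M (\<lambda>\<omega>. (\<theta> \<omega>)\<^sup>2)" and "0 < d"
  shows "integrable M (\<lambda>\<omega>. precautionary_loss (\<theta> \<omega>) d)"
    and "expected_loss M \<theta> precautionary_loss d =
      d - 2 * expectation \<theta> + (\<integral>\<omega>. (\<theta> \<omega>)\<^sup>2 \<partial>M) / d"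
  using \<open>0 < d\<close> by (simp_all add: expected_loss_def precautionary_loss_split prob_space)

end

theorem theorem1:
  fixes M :: "'a measure" and \<theta> :: "'a \<Rightarrow> real" and f :: "real \<Rightarrow> real" and k :: real
  assumes "prob_space M"
    and "\<And>x. 0 \<le> f x"
    and "distributed M lborel \<theta> (\<lambda>x. ennreal (f x))"
    and "AE \<omega> in M. 0 < \<theta> \<omega>"
    and "0 < k"
    and "integrable M (\<lambda>\<omega>. \<theta> \<omega> powr k)"
    and "integrable M (\<lambda>\<omega>. \<theta> \<omega> powr (- k))"
  shows "(\<forall>d. bayes_estimator M \<theta> (scale_loss k) d \<longleftrightarrow>
            d = ((\<integral>\<omega>. \<theta> \<omega> powr k \<partial>M) / (\<integral>\<omega>. \<theta> \<omega> powr (- k) \<partial>M)) powr (1 / (2 * k)))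
       \<and> (integrable M (\<lambda>\<omega>. (\<theta> \<omega>)\<^sup>2) \<longrightarrow>
            (\<forall>d. bayes_estimator M \<theta> precautionary_loss d \<longleftrightarrow>
               d = sqrt (\<integral>\<omega>. (\<theta> \<omega>)\<^sup>2 \<partial>M))
          \<and> sqrt (\<integral>\<omega>. (\<theta> \<omega>)\<^sup>2 \<partial>M) \<ge> (\<integral>\<omega>. \<theta> \<omega> \<partial>M))"
proof -
  interpret prob_space M by fact
  have meas [measurable]: "\<theta> \<in> borel_measurable M"
    using distributed_measurable[OF assms(3)] by simp
  have pos: "AE \<omega> in M. 0 < \<theta> \<omega>" by fact
  have "0 < (\<integral>\<omega>. \<theta> \<omega> powr (- k) \<partial>M)"
    by (rule expectation_greater) (use pos assms(7) in \<open>auto elim: eventually_mono\<close>)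
  moreover have "0 < (\<integral>\<omega>. \<theta> \<omega> powr k \<partial>M)"
    by (rule expectation_greater) (use pos assms(6) in \<open>auto elim: eventually_mono\<close>)
  ultimately have scale: "bayes_estimator M \<theta> (scale_loss k) d \<longleftrightarrow>
      d = ((\<integral>\<omega>. \<theta> \<omega> powr k \<partial>M) / (\<integral>\<omega>. \<theta> \<omega> powr (- k) \<partial>M)) powr (1 / (2 * k))" for d
    by (rule bayes_estimator_powr_balance[OF _ _ \<open>0 < k\<close>
          expected_scale_loss[OF meas pos _ assms(6,7)]])
  have precautionary: "(\<forall>d. bayes_estimator M \<theta> precautionary_loss d \<longleftrightarrow> d = sqrt S) \<and>
      expectation \<theta> \<le> sqrt S"
    if sq: "integrable M (\<lambda>\<omega>. (\<theta> \<omega>)\<^sup>2)" and S: "S = (\<integral>\<omega>. (\<theta> \<omega>)\<^sup>2 \<partial>M)" for S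
  proof
    have int: "integrable M \<theta>"
      using meas sq by (rule square_integrable_imp_integrable)
    note risk = expected_precautionary_loss[OF int sq, folded S]
    have "0 < S"
      unfolding S by (rule expectation_greater) (use pos sq in \<open>auto elim: eventually_mono\<close>)
    have "bayes_estimator M \<theta> precautionary_loss d \<longleftrightarrow> d = (S / 1) powr (1 / (2 * 1))" for d
      by (rule bayes_estimator_powr_balance[where c = "- 2 * expectation \<theta>"])
        (use \<open>0 < S\<close> risk in \<open>simp_all add: powr_minus divide_inverse\<close>)
    then show "\<forall>d. bayes_estimator M \<theta> precautionary_loss d \<longleftrightarrow> d = sqrt S"
      using \<open>0 < S\<close> by (simp add: powr_half_sqrt)
    \<comment> \<open>The bound on the mean: the minimal expected loss is the expectation of a nonnegative function.\<close>
    have "0 \<le> expected_loss M \<theta> precautionary_loss (sqrt S)"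
      unfolding expected_loss_def precautionary_loss_def
      using \<open>0 < S\<close> by (intro integral_nonneg_AE) simp
    also have "\<dots> = 2 * (sqrt S - expectation \<theta>)"
      using \<open>0 < S\<close> by (simp add: risk(2) real_div_sqrt)
    finally show "expectation \<theta> \<le> sqrt S" by simp
  qed
  show ?thesis
    using scale precautionary by blast
qed

end
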